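(* There exists a Sidon set $A$ of positive integers such that $\underline{d}(A+A+A) > 0.064$.
   Context: A set $A$ of positive integers is called a Sidon set if all two-term sums of elements of $A$ are different, i.e. for every positive integer $n$ the equation $a_1+a_2=n$ has at most one solution with $a_1,a_2\in A$, $a_1\le a_2$. The three-fold sumset is $A+A+A=\{a+a'+a'' : a,a',a''\in A\}$ (the elements $a,a',a''$ need not be distinct). For a set $X$ of positive integers, $X(n)$ denotes the number of elements of $X$ not exceeding $n$, and the lower asymptotic density of $X$ is $\underline{d}(X)=\liminf_{n\to\infty}\frac{X(n)}{n}$. *)

theory Defs
  imports Complex_Main "HOL-Library.Set_Algebras" "HOL-Library.Extended_Real"
begin

(* Sets of positive integers are sets of naturals not containing 0. *)

definition sidon :: "nat set \<Rightarrow> bool" where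
  "sidon A \<longleftrightarrow> 0 \<notin> A \<and>
     (\<forall>a1\<in>A. \<forall>a2\<in>A. \<forall>b1\<in>A. \<forall>b2\<in>A.
        a1 \<le> a2 \<longrightarrow> b1 \<le> b2 \<longrightarrow> a1 + a2 = b1 + b2 \<longrightarrow> a1 = b1 \<and> a2 = b2)"

definition counting :: "nat set \<Rightarrow> nat \<Rightarrow> nat" where
  "counting X n = card {x \<in> X. 1 \<le> x \<and> x \<le> n}"

(* The liminf is taken in the extended reals because the type real is not a complete
   lattice; since the quotients lie in [0,1], so does its value. *)
definition lower_density :: "nat set \<Rightarrow> ereal" where
  "lower_density X = liminf (\<lambda>n. ereal (real (counting X n) / real n))"

end

theory Submission imports Defs begin

text \<open>
  Choose greedily one element \<open>a\<^sub>t\<close> in each interval \<open>(2/3 t\<^sup>3, 2/3 (t + 1)\<^sup>3]\<close>, whose length is about \<open>2 t\<^sup>2\<close>.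
  The Sidon property forbids the values \<open>a\<^sub>j + a\<^sub>k - a\<^sub>i\<close> with \<open>i < j \<le> k < t\<close>. For fixed \<open>i\<close>, \<open>j\<close> at most
  three \<open>k\<close> give a value in the interval, and \<open>2 a\<^sub>j \<le> a\<^sub>j + a\<^sub>k = x + a\<^sub>i\<close> forces \<open>j \<le> 4/5 t + 1/5 i + O(1)\<close>;
  so at most about \<open>3 * 2/5 t\<^sup>2\<close> values are forbidden and \<open>4/5 t\<^sup>2\<close> remain.

  Let \<open>P\<^sub>t\<close> be the set of sums \<open>a\<^sub>i + a\<^sub>j \<le> 2/3 t\<^sup>3\<close> with \<open>i, j < t\<close>. Among the remaining values pick the one for
  which \<open>a\<^sub>t + P\<^sub>t\<close> overlaps least with the sums covered before. Averaging over the choices, each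
  covered \<open>y\<close> is charged with total weight at most \<open>(X\<^sup>2 / 2) / (4/5 X\<^sup>2) = 5/8\<close>, where \<open>X\<close> is the first \<open>t\<close>
  with \<open>y \<in> a\<^sub>t + P\<^sub>t\<close> possible: the sums \<open>s < y / 2\<close> only involve indices up to \<open>X\<close>. Hence the number of
  covered sums after \<open>n\<close> steps, all of them at most \<open>4/3 n\<^sup>3\<close>, is at least \<open>(\<Sum>t<n. |P\<^sub>t|) / 1.63\<close> with
  \<open>|P\<^sub>t|\<close> about \<open>0.426 t\<^sup>2\<close>, which gives the density \<open>0.142 / 1.63 * 3/4 > 0.065\<close>. Starting at \<open>t = 1000\<close>
  makes the lower order terms harmless.
\<close>

section \<open>Cubic windows and the values that preserve the Sidon property\<close>

definition u :: "nat \<Rightarrow> nat" where "u t = 2 * t ^ 3 div 3"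

definition window :: "nat \<Rightarrow> nat set" where "window t = {u t<..u (Suc t)}"

text \<open>If \<open>x\<close> exceeds every element of \<open>A\<close>, only an equation
  \<open>x + a = b + c\<close> can break the Sidon property: \<open>2 * x\<close> is too large to
  equal \<open>b + c\<close>, and \<open>x\<close> cancels from all other equations.\<close>

definition free :: "nat \<Rightarrow> nat set \<Rightarrow> nat set" where
  "free t A = {x \<in> window t. \<not> (\<exists>a\<in>A. \<exists>b\<in>A. \<exists>c\<in>A. x + a = b + c)}"

text \<open>The cut at \<open>u t\<close> makes \<open>s\<close> less than half of
  \<open>a t + s\<close>, which limits overlaps, and keeps \<open>a t + s\<close> below twice the
  end of the window.\<close>

definition low_sums :: "nat \<Rightarrow> nat set \<Rightarrow> nat set" where
  "low_sums t A = {s. \<exists>a\<in>A. \<exists>b\<in>A. s = a + b \<and> s \<le> u t}"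

lemma u_upper: "3 * u t \<le> 2 * t ^ 3" and u_lower: "2 * t ^ 3 \<le> 3 * u t + 2"
  unfolding u_def by linarith+

lemma u_upper_real: "real (u t) \<le> 2 / 3 * real t ^ 3"
proof -
  have "real (3 * u t) \<le> real (2 * t ^ 3)" using u_upper by (intro of_nat_mono)
  then show ?thesis by simp
qed

lemma u_lower_real: "real (u t) \<ge> 2 / 3 * real t ^ 3 - 2 / 3"
proof -
  have "real (2 * t ^ 3) \<le> real (3 * u t + 2)" using u_lower by (intro of_nat_mono)
  then show ?thesis by simp
qed

lemma u_mono: "s \<le> t \<Longrightarrow> u s \<le> u t"
  unfolding u_def by (intro div_le_mono mult_le_mono2 power_mono) auto

text \<open>Rounding down is superadditive.\<close>

lemma u_add_le: "i ^ 3 + j ^ 3 \<le> t ^ 3 \<Longrightarrow> u i + u j \<le> u t"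
  unfolding u_def by linarith

lemma finite_window [simp]: "finite (window t)"
  by (simp add: window_def)

text \<open>The cubes differ by 3 (2 t^2 + 2 t) + 2 after doubling, and the surplus 2 pays for
  rounding \<open>u (Suc t)\<close> down.\<close>

lemma card_window: "real (card (window t)) \<ge> 2 * real t ^ 2 + 2 * real t"
proof -
  have "3 * u (Suc t) + 2 \<ge> 2 * Suc t ^ 3" "3 * u t \<le> 2 * t ^ 3" "3 * u (Suc t) \<le> 2 * Suc t ^ 3"
    using u_lower u_upper by blast+
  moreover have "2 * Suc t ^ 3 = 2 * t ^ 3 + 3 * (2 * t ^ 2 + 2 * t) + 2"
    by (simp add: power3_eq_cube power2_eq_square algebra_simps)
  ultimately have "3 * u (Suc t) \<ge> 3 * u t + 3 * (2 * t ^ 2 + 2 * t)" by linarith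
  then have "card (window t) \<ge> 2 * t ^ 2 + 2 * t" by (simp add: window_def)
  then have "real (card (window t)) \<ge> real (2 * t ^ 2 + 2 * t)" by (intro of_nat_mono)
  then show ?thesis by simp
qed

lemma windows_ordered: "i < j \<Longrightarrow> x \<in> window i \<Longrightarrow> y \<in> window j \<Longrightarrow> x < y"
  using u_mono[of "Suc i" j] by (auto simp: window_def)

text \<open>Two solutions with indices \<open>k\<close> and \<open>l \<ge> k + 3\<close> satisfy a_l
  - a_k = y - x. Two full windows separate a_k from a_l, so the left side is at least about 4 k^2.
  As 2 a_k > \<open>u t\<close> forces k to be about 0.79 t or more, this is about 2.49 t^2, more
  than the window length 2 t^2.\<close>

lemma card_solutions_le_3:
  assumes I: "I \<subseteq> {..<t}" and a: "\<And>i. i \<in> I \<Longrightarrow> a i \<in> window i"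
    and i: "i \<in> I" and j: "j \<in> I"
  shows "card {x \<in> window t. \<exists>k\<in>I. j \<le> k \<and> x + a i = a j + a k} \<le> 3"
proof -
  define K where "K = {k \<in> I. j \<le> k \<and> (\<exists>x\<in>window t. x + a i = a j + a k)}"
  have fK: "finite K" by (rule finite_subset[of _ "{..<t}"]) (use I in \<open>auto simp: K_def\<close>)
  have near: "l \<le> k + 2" if k: "k \<in> K" and l: "l \<in> K" for k l
  proof (rule ccontr)
    assume "\<not> l \<le> k + 2"
    then have kl: "k + 3 \<le> l" by simp
    obtain x y where x: "x \<in> window t" "x + a i = a j + a k"
      and y: "y \<in> window t" "y + a i = a j + a l"
      using k l unfolding K_def by blast
    have wk: "a k \<in> window k" and wl: "a l \<in> window l" and wj: "a j \<in> window j"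
      and "j \<le> k"
      using k l a j by (auto simp: K_def)
    have "a j \<le> a k"
      using windows_ordered[OF _ wj wk] \<open>j \<le> k\<close> by (cases "j = k") auto
    then have "u t + 1 \<le> 2 * u (Suc k)" using x wk by (auto simp: window_def)
    then have "real (u t) + 1 \<le> 2 * real (u (Suc k))" by linarith
    define m where "m = real (Suc k)"
    have "real t ^ 3 \<le> 2 * m ^ 3"
      using \<open>real (u t) + 1 \<le> _\<close> u_lower_real[of t] u_upper_real[of "Suc k"] unfolding m_def by linarith
    \<comment> \<open>0.79 lies just below the cube root of 1/2.\<close>
    have m: "m \<ge> 79 / 100 * real t"
    proof (rule ccontr)
      assume "\<not> m \<ge> 79 / 100 * real t"
      then have "m < 79 / 100 * real t" by simp
      then have "m ^ 3 < (79 / 100 * real t) ^ 3" by (intro power_strict_mono) (auto simp: m_def)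
      also have "\<dots> = 493039 / 1000000 * real t ^ 3" by (simp add: power_mult_distrib power3_eq_cube)
      finally show False using \<open>real t ^ 3 \<le> 2 * m ^ 3\<close> zero_le_power[OF of_nat_0_le_iff, of t 3, where ?'a = real]
      by linarith
    qed
    have "m ^ 2 \<ge> (79 / 100 * real t) ^ 2" using m by (intro power_mono) auto
    then have m2: "m ^ 2 \<ge> 6241 / 10000 * real t ^ 2" by (simp add: power_mult_distrib power2_eq_square)
    have "a l > u (k + 3)" using u_mono[OF kl] wl by (auto simp: window_def)
    moreover have "a k \<le> u (Suc k)" using wk by (simp add: window_def)
    moreover have "u t < x" "y \<le> u (Suc t)" using x y by (auto simp: window_def)
    ultimately have "u (k + 3) + u t + 2 \<le> u (Suc k) + u (Suc t)" using x(2) y(2) by linarith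
    then have "real (u (k + 3)) + real (u t) + 2 \<le> real (u (Suc k)) + real (u (Suc t))" by linarith
    then have "2 / 3 * real (k + 3) ^ 3 + 2 / 3 * real t ^ 3 + 2 / 3 
        \<le> 2 / 3 * m ^ 3 + 2 / 3 * real (Suc t) ^ 3"
      using u_lower_real[of "k + 3"] u_lower_real[of t] u_upper_real[of "Suc k"]
        u_upper_real[of "Suc t"] unfolding m_def by linarith
    moreover have "real (k + 3) ^ 3 = m ^ 3 + 6 * m ^ 2 + 12 * m + 8"
      by (simp add: m_def power3_eq_cube power2_eq_square algebra_simps)
    moreover have "real (Suc t) ^ 3 = real t ^ 3 + 3 * real t ^ 2 + 3 * real t + 1"
      by (simp add: power3_eq_cube power2_eq_square algebra_simps)
    moreover have "real t ^ 2 \<ge> 0" by simp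
    ultimately show False using m m2 by linarith
  qed
  have "card K \<le> 3"
  proof (cases "K = {}")
    case False
    then have "K \<subseteq> {Min K..Min K + 2}"
      using near[OF Min_in[OF fK False]] fK by auto
    then have "card K \<le> card {Min K..Min K + 2}" by (intro card_mono) auto
    then show ?thesis by simp
  qed simp
  moreover have "{x \<in> window t. \<exists>k\<in>I. j \<le> k \<and> x + a i = a j + a k}
      \<subseteq> (\<lambda>k. a j + a k - a i) ` K"
    unfolding K_def by force
  then have "card {x \<in> window t. \<exists>k\<in>I. j \<le> k \<and> x + a i = a j + a k} \<le> card K"
    using fK by (meson card_image_le card_mono finite_imageI le_trans)
  ultimately show ?thesis by simp
qed

text \<open>A linear majorant of the cubic mean of \<open>p\<close> and \<open>q\<close>, exact at
  \<open>p = q\<close>. After expansion the mixed terms are replaced by \<open>q ^ 3\<close>, and 64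
  p^3 + 61 q^3 is at least 62.5 (p^3 + q^3).\<close>

lemma half_cube_sum_bound:
  fixes p q j :: real
  assumes "0 \<le> q" "q \<le> p" "2 * j ^ 3 \<le> p ^ 3 + q ^ 3"
  shows "j \<le> 4 / 5 * p + 1 / 5 * q"
proof (rule ccontr)
  assume "\<not> ?thesis"
  then have "(4 / 5 * p + 1 / 5 * q) ^ 3 < j ^ 3"
    using assms by (intro power_strict_mono) auto
  moreover have "125 * (4 / 5 * p + 1 / 5 * q) ^ 3
      = 64 * p ^ 3 + 48 * (p ^ 2 * q) + 12 * (p * q ^ 2) + q ^ 3"
    by (simp add: power3_eq_cube power2_eq_square algebra_simps)
  moreover have "q ^ 3 \<le> p ^ 3" using assms by (intro power_mono) auto
  moreover have "q ^ 3 \<le> p ^ 2 * q"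
    using mult_right_mono[OF power_mono[of q p 2], of q] assms
    by (simp add: power3_eq_cube power2_eq_square)
  moreover have "q ^ 3 \<le> p * q ^ 2"
    using mult_right_mono[of q p "q ^ 2"] assms by (simp add: power3_eq_cube power2_eq_square)
  ultimately show False using assms(3) by linarith
qed

lemma sum_lessThan_real: "(\<Sum>i<n. real i) = real n * (real n - 1) / 2"
  by (induction n) (auto simp: field_simps)

text \<open>The intersection makes the split valid for \<open>n < m\<close> too.\<close>

lemma sum_lessThan_split:
  fixes f :: "nat \<Rightarrow> real"
  shows "(\<Sum>i<n. f i) = (\<Sum>i\<in>{..<n} \<inter> {..<m}. f i) + (\<Sum>i=m..<n. f i)"
proof -
  have "{..<n} = ({..<n} \<inter> {..<m}) \<union> {m..<n}" by auto
  then have "(\<Sum>i<n. f i) = sum f (({..<n} \<inter> {..<m}) \<union> {m..<n})" by (rule arg_cong)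
  also have "\<dots> = (\<Sum>i\<in>{..<n} \<inter> {..<m}. f i) + (\<Sum>i=m..<n. f i)"
    by (intro sum.union_disjoint) auto
  finally show ?thesis .
qed

text \<open>Each forbidden value is charged to \<open>(i, j)\<close>, where \<open>j\<close> is the
  smaller index on the right of \<open>x + a i = a j + a k\<close>. Each pair in \<open>Q\<close> is
  charged at most three times.\<close>

lemma card_free:
  assumes I: "I \<subseteq> {..<t}" and a: "\<And>i. i \<in> I \<Longrightarrow> a i \<in> window i" and t: "t \<ge> 1"
  shows "real (card (free t (a ` I))) \<ge> 4 / 5 * real t ^ 2 - 11 / 5 * real t"
proof -
  \<comment> \<open>The bound on \<open>j\<close> is 4/5 (t + 1) + 1/5 (i + 1), which produces the 5
    in the numerator.\<close>
  define Q where "Q = (SIGMA i:{..<t}. {i<..(4 * t + i + 5) div 5})"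
  define G where "G = (\<lambda>(i, j). if i \<in> I \<and> j \<in> I 
      then {x \<in> window t. \<exists>k\<in>I. j \<le> k \<and> x + a i = a j + a k} else {})"
  have fQ: "finite Q" by (simp add: Q_def)
  have G3: "card (G p) \<le> 3" for p
    using card_solutions_le_3[OF I a] by (auto simp: G_def split: prod.splits)
  have key: "x \<in> (\<Union>p\<in>Q. G p)"
    if x: "x \<in> window t" and ijk: "i \<in> I" "j \<in> I" "k \<in> I" "j \<le> k" "x + a i = a j + a k" for x i j k
  proof -
    have less: "k < t" "i < t" "j < t" using I ijk by auto
    have wi: "a i \<in> window i" "a j \<in> window j" "a k \<in> window k" using a ijk by auto
    have "a k < x" using windows_ordered[OF less(1)] wi x by auto
    then have "a i < a j" using ijk by linarith
    then have ij: "i < j"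
      using windows_ordered[of j i "a j" "a i"] wi by (metis linorder_neqE_nat order_less_asym)
    have "a j \<le> a k" using windows_ordered[OF _ wi(2,3)] \<open>j \<le> k\<close> by (cases "j = k") auto
    \<comment> \<open>From 2 a_j \<le> a_j + a_k = x + a_i; the 2 comes from the open left ends of
      the windows and absorbs the rounding in \<open>u\<close>.\<close>
    then have "2 * u j + 2 \<le> u (Suc t) + u (Suc i)" using x wi ijk(5) by (auto simp: window_def)
    then have "2 * j ^ 3 \<le> Suc t ^ 3 + Suc i ^ 3"
      using u_lower[of j] u_upper[of "Suc t"] u_upper[of "Suc i"] by linarith
    then have "real (2 * j ^ 3) \<le> real (Suc t ^ 3 + Suc i ^ 3)" by (intro of_nat_mono)
    then have "2 * real j ^ 3 \<le> real (Suc t) ^ 3 + real (Suc i) ^ 3" by (simp only: of_nat_mult of_nat_add of_nat_power of_nat_numeral)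
    then have "real j \<le> 4 / 5 * real (Suc t) + 1 / 5 * real (Suc i)"
      using less by (intro half_cube_sum_bound) auto
    then have "real (5 * j) \<le> real (4 * t + i + 5)" by (simp add: field_simps)
    then have "5 * j \<le> 4 * t + i + 5" by (simp only: of_nat_le_iff)
    then have "(i, j) \<in> Q" using ij less by (auto simp: Q_def)
    moreover have "x \<in> G (i, j)" using x ijk by (auto simp: G_def)
    ultimately show ?thesis by blast
  qed
  have sub: "window t - free t (a ` I) \<subseteq> (\<Union>p\<in>Q. G p)"
  proof
    fix x assume "x \<in> window t - free t (a ` I)"
    then obtain i j k where x: "x \<in> window t" "i \<in> I" "j \<in> I" "k \<in> I" "x + a i = a j + a k"
      by (auto simp: free_def)
    then show "x \<in> (\<Union>p\<in>Q. G p)"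
      using key[of x i j k] key[of x i k j] by (metis add.commute nat_le_linear)
  qed
  have "real (card (window t - free t (a ` I))) \<le> 3 * real (card Q)"
  proof -
    have "card (window t - free t (a ` I)) \<le> card (\<Union>p\<in>Q. G p)"
      using sub fQ by (intro card_mono) (auto simp: G_def)
    also have "\<dots> \<le> (\<Sum>p\<in>Q. card (G p))" by (rule card_UN_le[OF fQ])
    also have "\<dots> \<le> (\<Sum>p\<in>Q. 3)" by (intro sum_mono G3)
    finally show ?thesis by simp
  qed
  moreover have "real (card Q) \<le> 2 / 5 * real t ^ 2 + 7 / 5 * real t"
  proof -
    have "real (card Q) = (\<Sum>i<t. real ((4 * t + i + 5) div 5 - i))"
      by (simp add: Q_def)
    also have "\<dots> \<le> (\<Sum>i<t. 4 / 5 * real t + 1 - 4 / 5 * real i)"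
      by (intro sum_mono) (auto simp: field_simps)
    also have "\<dots> = (4 / 5 * real t + 1) * real t - 4 / 5 * (real t * (real t - 1) / 2)"
      by (simp add: sum_subtractf sum_distrib_left[symmetric] sum_lessThan_real del: times_divide_eq_left)
    also have "\<dots> = 2 / 5 * real t ^ 2 + 7 / 5 * real t"
      by (simp add: field_simps power2_eq_square)
    finally show ?thesis .
  qed
  moreover have "card (window t) = card (window t - free t (a ` I)) + card (free t (a ` I))"
    using card_Diff_subset[of "free t (a ` I)" "window t"] card_mono[of "window t" "free t (a ` I)"]
    by (auto simp: free_def)
  ultimately show ?thesis using card_window[of t] by linarith
qed

section \<open>The greedy choice by averaging\<close>

text \<open>Summed over \<open>x \<in> F\<close>, the overlaps count the pairs \<open>(x, s)\<close>
  with \<open>x + s \<in> S\<close>, and some \<open>x\<close> does no worse than average. Enlarging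
  \<open>F\<close> to \<open>W\<close> on the right gives a bound that does not depend on which
  values are free.\<close>

lemma averaging_choice:
  fixes F W P S :: "nat set"
  assumes "finite F" "F \<noteq> {}" "finite W" "F \<subseteq> W" "finite P"
  shows "\<exists>x\<in>F. card F * card ((+) x ` P \<inter> S) \<le> (\<Sum>s\<in>P. card ((+) s ` W \<inter> S))"
proof (rule ccontr)
  assume no: "\<not> ?thesis"
  let ?R = "\<Sum>s\<in>P. card ((+) s ` W \<inter> S)"
  have "card F * ?R = (\<Sum>x\<in>F. ?R)" by simp
  also have "\<dots> < (\<Sum>x\<in>F. card F * card ((+) x ` P \<inter> S))"
    using no assms by (intro sum_strict_mono) auto
  also have "\<dots> = card F * (\<Sum>x\<in>F. card ((+) x ` P \<inter> S))" by (simp add: sum_distrib_left)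
  also have "(\<Sum>x\<in>F. card ((+) x ` P \<inter> S)) = (\<Sum>x\<in>F. card {s \<in> P. x + s \<in> S})"
  proof (intro sum.cong refl)
    fix x
    have "(+) x ` P \<inter> S = (+) x ` {s \<in> P. x + s \<in> S}" by auto
    then show "card ((+) x ` P \<inter> S) = card {s \<in> P. x + s \<in> S}" by (simp add: card_image)
  qed
  also have "\<dots> = (\<Sum>s\<in>P. card {x \<in> F. x + s \<in> S})"
    using assms by (intro sum_multicount_gen) auto
  also have "\<dots> \<le> ?R"
  proof (intro sum_mono)
    fix s
    have "card {x \<in> F. x + s \<in> S} = card ((+) s ` {x \<in> F. x + s \<in> S})" by (simp add: card_image)
    also have "\<dots> \<le> card ((+) s ` W \<inter> S)"
      using assms by (intro card_mono) (auto simp: add.commute)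
    finally show "card {x \<in> F. x + s \<in> S} \<le> card ((+) s ` W \<inter> S)" .
  qed
  finally show False by simp
qed


text \<open>The state consists of the chosen elements and the covered sums. It stays empty up to
  1000, so that the step number is also the window number.\<close>

primrec greedy_state :: "nat \<Rightarrow> nat set \<times> nat set" where
  "greedy_state 0 = ({}, {})"
| "greedy_state (Suc t) = (let (A, S) = greedy_state t; P = low_sums t A in
     if t < 1000 then ({}, {}) else
       (let x = (SOME x. x \<in> free t A \<and> card (free t A) * card ((+) x ` P \<inter> S)
              \<le> (\<Sum>s\<in>P. card ((+) s ` window t \<inter> S)))
        in (insert x A, S \<union> (+) x ` P)))"

definition covered :: "(nat \<Rightarrow> nat) \<Rightarrow> nat \<Rightarrow> nat set" where
  "covered a t = (\<Union>i\<in>{1000..<t}. (+) (a i) ` low_sums i (a ` {1000..<i}))"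

lemma covered_Suc:
  "t \<ge> 1000 \<Longrightarrow> covered a (Suc t) = covered a t \<union> (+) (a t) ` low_sums t (a ` {1000..<t})"
  by (auto simp: covered_def atLeastLessThanSuc)

lemma finite_low_sums [simp]: "finite (low_sums t A)"
  by (rule finite_subset[of _ "{..u t}"]) (auto simp: low_sums_def)

lemma finite_covered [simp]: "finite (covered a t)"
  by (simp add: covered_def)

lemma covered_mono: "s \<le> t \<Longrightarrow> covered a s \<subseteq> covered a t"
  unfolding covered_def by (intro UN_mono) auto

text \<open>Isolates what the later estimates use of the sequence, without the choice
  operator.\<close>

locale greedy =
  fixes a :: "nat \<Rightarrow> nat"
  assumes in_free: "t \<ge> 1000 \<Longrightarrow> a t \<in> free t (a ` {1000..<t})"
    and small_overlap: "t \<ge> 1000 \<Longrightarrow>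
      card (free t (a ` {1000..<t})) * card ((+) (a t) ` low_sums t (a ` {1000..<t}) \<inter> covered a t)
        \<le> (\<Sum>s\<in>low_sums t (a ` {1000..<t}). card ((+) s ` window t \<inter> covered a t))"

lemma card_free_initial:
  assumes "\<And>i. i \<ge> 1000 \<Longrightarrow> i < t \<Longrightarrow> a i \<in> window i" "t \<ge> 1000"
  shows "real (card (free t (a ` {1000..<t}))) \<ge> 4 / 5 * real t ^ 2 - 11 / 5 * real t"
  using assms by (intro card_free) auto

text \<open>The quadratic is the lower bound for the number of free values; it is a product of two
  increasing positive factors.\<close>

lemma avail_mono:
  assumes "1000 \<le> s" "s \<le> (t::real)"
  shows "0 < 4 / 5 * s ^ 2 - 11 / 5 * s" "4 / 5 * s ^ 2 - 11 / 5 * s \<le> 4 / 5 * t ^ 2 - 11 / 5 * t"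
proof -
  have "0 < s * (4 / 5 * s - 11 / 5)" using assms by (intro mult_pos_pos) auto
  then show "0 < 4 / 5 * s ^ 2 - 11 / 5 * s" by (simp add: algebra_simps power2_eq_square)
  have "s * (4 / 5 * s - 11 / 5) \<le> t * (4 / 5 * t - 11 / 5)" using assms by (intro mult_mono) auto
  then show "4 / 5 * s ^ 2 - 11 / 5 * s \<le> 4 / 5 * t ^ 2 - 11 / 5 * t" by (simp add: algebra_simps power2_eq_square)
qed

text \<open>Strong induction: once all earlier elements lie in their windows,
  \<open>card_free\<close> leaves free values, so the averaging argument applies and the choice
  operator has a witness.\<close>

lemma greedy_exists: "\<exists>a. greedy a"
proof -
  define A where "A t = fst (greedy_state t)" for t
  define S where "S t = snd (greedy_state t)" for t
  define good where "good t x \<longleftrightarrow> x \<in> free t (A t) \<and>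
    card (free t (A t)) * card ((+) x ` low_sums t (A t) \<inter> S t)
      \<le> (\<Sum>s\<in>low_sums t (A t). card ((+) s ` window t \<inter> S t))" for t x
  define a where "a t = (SOME x. good t x)" for t
  have step: "A (Suc t) = insert (a t) (A t)" "S (Suc t) = S t \<union> (+) (a t) ` low_sums t (A t)"
    if "t \<ge> 1000" for t
    using that by (simp_all add: A_def S_def a_def good_def Let_def split: prod.splits)
  have "t \<le> 1000 \<Longrightarrow> greedy_state t = ({}, {})" for t
    by (induction t) (auto simp: Let_def)
  then have base: "A 1000 = {}" "S 1000 = {}"
    by (simp_all add: A_def S_def)
  have A: "A t = a ` {1000..<t}" if "t \<ge> 1000" for t
    using that by (induction t rule: dec_induct) (auto simp: base step atLeastLessThanSuc)
  have S: "S t = covered a t" if "t \<ge> 1000" for t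
    using that by (induction t rule: dec_induct) (auto simp: base step covered_Suc A covered_def[of _ 1000])
  have good: "good t (a t)" if "t \<ge> 1000" for t
    using that
  proof (induction t rule: less_induct)
    case (less t)
    have "a i \<in> window i" if "1000 \<le> i" "i < t" for i
      using less.IH[of i] that by (simp add: good_def free_def)
    then have "real (card (free t (A t))) \<ge> 4 / 5 * real t ^ 2 - 11 / 5 * real t"
      using card_free_initial less.prems A by simp
    then have "card (free t (A t)) > 0"
      using avail_mono(1)[of "real t" "real t"] less.prems by linarith
    then have "\<exists>x\<in>free t (A t). card (free t (A t)) * card ((+) x ` low_sums t (A t) \<inter> S t)
      \<le> (\<Sum>s\<in>low_sums t (A t). card ((+) s ` window t \<inter> S t))"
      by (intro averaging_choice) (auto simp: card_gt_0_iff free_def)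
    then have "\<exists>x. good t x" by (auto simp: good_def)
    then show ?case unfolding a_def by (rule someI_ex)
  qed
  have "greedy a"
    by unfold_locales (use good A S in \<open>auto simp: good_def\<close>)
  then show ?thesis by blast
qed

section \<open>The Sidon property\<close>

context greedy
begin

lemma in_window: "t \<ge> 1000 \<Longrightarrow> a t \<in> window t"
  using in_free by (auto simp: free_def)

lemma a_bounds: "t \<ge> 1000 \<Longrightarrow> u t < a t" "t \<ge> 1000 \<Longrightarrow> a t \<le> u (Suc t)"
  using in_window by (auto simp: window_def)

lemma a_less: "1000 \<le> i \<Longrightarrow> i < j \<Longrightarrow> a i < a j"
  using windows_ordered[of i j] in_window by simp

lemma a_le_iff: "1000 \<le> i \<Longrightarrow> 1000 \<le> j \<Longrightarrow> a i \<le> a j \<longleftrightarrow> i \<le> j"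
  using a_less[of i j] a_less[of j i] by (metis linorder_not_le nat_less_le order_refl)

lemma a_eq_iff: "1000 \<le> i \<Longrightarrow> 1000 \<le> j \<Longrightarrow> a i = a j \<longleftrightarrow> i = j"
  using a_le_iff by (metis order_antisym order_refl)

lemma no_solution:
  assumes "1000 \<le> i" "i < t" "1000 \<le> j" "j < t" "1000 \<le> k" "k < t"
  shows "a t + a i \<noteq> a j + a k"
  using in_free[of t] assms unfolding free_def by force

text \<open>If \<open>l\<close> were the largest index, \<open>a l\<close> would either solve an
  equation excluded by its freeness, or occur twice and make the right side too large.\<close>

lemma larger_summand_unique:
  assumes "1000 \<le> i" "i \<le> j" "1000 \<le> k" "k \<le> l" "a i + a j = a k + a l"
  shows "l \<le> j"
proof (rule ccontr)
  assume "\<not> l \<le> j"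
  then have "j < l" by simp
  show False
  proof (cases "k < l")
    case True
    then show ?thesis using no_solution[of k l i j] assms \<open>j < l\<close> by (simp add: add.commute)
  next
    case False
    then have "a i < a k" "a j < a l" using a_less assms \<open>j < l\<close> by auto
    then show ?thesis using assms by linarith
  qed
qed

lemma sum_unique:
  assumes "1000 \<le> i" "i \<le> j" "1000 \<le> k" "k \<le> l" "a i + a j = a k + a l"
  shows "i = k \<and> j = l"
proof -
  have "j = l" using larger_summand_unique[of i j k l] larger_summand_unique[of k l i j] assms by auto
  then show ?thesis using assms a_eq_iff by auto
qed

lemma sidon: "sidon (a ` {1000..})"
proof -
  have "0 \<notin> a ` {1000..}" using a_bounds(1) by force
  moreover have "a1 = b1 \<and> a2 = b2"
    if in_A: "a1 \<in> a ` {1000..}" "a2 \<in> a ` {1000..}" "b1 \<in> a ` {1000..}" "b2 \<in> a ` {1000..}"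
      and eq: "a1 \<le> a2" "b1 \<le> b2" "a1 + a2 = b1 + b2" for a1 a2 b1 b2
  proof -
    obtain i j k l where ix: "a1 = a i" "a2 = a j" "b1 = a k" "b2 = a l"
      "1000 \<le> i" "1000 \<le> j" "1000 \<le> k" "1000 \<le> l"
      using in_A by auto
    then have "i = k \<and> j = l" using eq a_le_iff by (intro sum_unique) auto
    then show ?thesis using ix by simp
  qed
  ultimately show ?thesis unfolding sidon_def by blast
qed

section \<open>Double counting of the covered sums\<close>

definition P :: "nat \<Rightarrow> nat set" where "P t = low_sums t (a ` {1000..<t})"

lemma finite_P [simp]: "finite (P t)" by (simp add: P_def)

lemma P_elem:
  assumes "s \<in> P t"
  obtains i j where "1000 \<le> i" "i \<le> j" "j < t" "s = a i + a j" "s \<le> u t"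
proof -
  obtain i j where "i \<in> {1000..<t}" "j \<in> {1000..<t}" "s = a i + a j" "s \<le> u t"
    using assms by (auto simp: P_def low_sums_def)
  then show ?thesis using that[of i j] that[of j i] by (cases "i \<le> j") auto
qed

lemma card_pairs_le: "card {(i, j). i \<le> j \<and> j \<le> (n::nat)} \<le> (n + 1) * (n + 2) div 2"
proof -
  have "{(i, j). i \<le> j \<and> j \<le> n} = prod.swap ` (SIGMA j:{..n}. {..j})" by force
  then have "card {(i, j). i \<le> j \<and> j \<le> n} = (\<Sum>j\<le>n. Suc j)"
    by (simp add: card_image)
  also have "\<dots> = (n + 1) * (n + 2) div 2" by (induction n) auto
  finally show ?thesis by simp
qed

text \<open>With \<open>X\<close> the least \<open>t\<close> in \<open>Z\<close>, all the
  \<open>s\<close> are sums of two elements with indices at most \<open>X\<close>, about X^2 / 2 in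
  number, and every weight is at most that of \<open>X\<close>.\<close>

lemma overlap_weight:
  fixes y n :: nat
  defines "Z \<equiv> {(t, s). t \<in> {1000..<n} \<and> s \<in> P t \<and> y \<in> (+) s ` window t}"
  shows "(\<Sum>(t, s)\<in>Z. 1 / (4 / 5 * real t ^ 2 - 11 / 5 * real t)) \<le> 63 / 100"
proof (cases "Z = {}")
  case False
  define w where "w t = 4 / 5 * real t ^ 2 - 11 / 5 * real t" for t :: nat
  have fZ: "finite Z"
    by (rule finite_subset[of _ "SIGMA t:{1000..<n}. P t"]) (auto simp: Z_def)
  define X where "X = Min (fst ` Z)"
  have XZ: "X \<in> fst ` Z" unfolding X_def using fZ False by (intro Min_in) auto
  then obtain s0 where s0: "(X, s0) \<in> Z" by auto
  have Xle: "X \<le> t" if "(t, s) \<in> Z" for t s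
    unfolding X_def using fZ that by (intro Min_le) force+
  have X: "X \<ge> 1000" and y: "y \<le> u X + u (Suc X)"
    using s0 by (auto simp: Z_def window_def elim!: P_elem)
  \<comment> \<open>For fixed \<open>y\<close>, \<open>s\<close> determines \<open>t\<close>,
    because \<open>y - s\<close> lies in only one window.\<close>
  have "inj_on snd Z"
  proof (rule inj_onI)
    fix p q assume "p \<in> Z" "q \<in> Z" "snd p = snd q"
    then obtain s t r where p: "p = (t, s)" "q = (r, s)" by (metis prod.collapse)
    then have "y - s \<in> window t" "y - s \<in> window r" using \<open>p \<in> Z\<close> \<open>q \<in> Z\<close> by (auto simp: Z_def)
    then have "t = r" using windows_ordered by (metis less_irrefl linorder_neqE_nat)
    then show "p = q" using p by simp
  qed
  then have "card Z = card (snd ` Z)" by (simp add: card_image)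
  also have "\<dots> \<le> card ((\<lambda>(i, j). a i + a j) ` {(i, j). i \<le> j \<and> j \<le> X})"
  proof (intro card_mono subsetI)
    show "finite ((\<lambda>(i, j). a i + a j) ` {(i, j). i \<le> j \<and> j \<le> X})"
      by (intro finite_imageI finite_subset[of "{(i, j). i \<le> j \<and> j \<le> X}" "{..X} \<times> {..X}"]) auto
    fix s assume "s \<in> snd ` Z"
    then obtain t where t: "s \<in> P t" "y \<in> (+) s ` window t" by (auto simp: Z_def)
    then obtain i j where ij: "1000 \<le> i" "i \<le> j" "j < t" "s = a i + a j" "s \<le> u t"
      by (elim P_elem)
    \<comment> \<open>Together with \<open>s \<le> u t\<close> this yields 2 s < y.\<close>
    have "u t + s < y" using t(2) by (auto simp: window_def)
    then have "s < u (Suc X)" using y ij u_mono[of X "Suc X"] by linarith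
    then have "u j < u (Suc X)" using a_bounds(1)[of j] ij by linarith
    then have "j \<le> X" using u_mono[of "Suc X" j] by (meson leD not_less_eq_eq)
    then show "s \<in> (\<lambda>(i, j). a i + a j) ` {(i, j). i \<le> j \<and> j \<le> X}" using ij by force
  qed
  also have "\<dots> \<le> card {(i, j). i \<le> j \<and> j \<le> X}"
    by (intro card_image_le finite_subset[of "{(i, j). i \<le> j \<and> j \<le> X}" "{..X} \<times> {..X}"]) auto
  also have "\<dots> \<le> (X + 1) * (X + 2) div 2" by (rule card_pairs_le)
  finally have "2 * card Z \<le> (X + 1) * (X + 2)" by linarith
  then have "real (2 * card Z) \<le> real ((X + 1) * (X + 2))" by (intro of_nat_mono)
  then have cZ: "real (card Z) \<le> (real X ^ 2 + 3 * real X + 2) / 2"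
    by (simp add: power2_eq_square algebra_simps)
  have wX: "0 < w X" using avail_mono(1)[of "real X" "real X"] X by (simp add: w_def)
  have "(\<Sum>(t, s)\<in>Z. 1 / w t) \<le> (\<Sum>(t, s)\<in>Z. 1 / w X)"
  proof (intro sum_mono)
    fix p assume "p \<in> Z"
    then obtain t s where p: "p = (t, s)" "(t, s) \<in> Z" by (cases p) auto
    have "w X \<le> w t" using avail_mono(2)[of "real X" "real t"] X Xle[OF p(2)] by (simp add: w_def)
    then show "(case p of (t, s) \<Rightarrow> 1 / w t) \<le> (case p of (t, s) \<Rightarrow> 1 / w X)"
      using wX p by (simp add: frac_le)
  qed
  also have "\<dots> = real (card Z) / w X" by simp
  also have "\<dots> \<le> 63 / 100"
  proof -
    \<comment> \<open>0.63 * 0.8 exceeds 1/2 by 0.004, and 0.004 X^2 \<ge> 4 X covers the lower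
      order terms.\<close>
    have "1000 * real X \<le> real X ^ 2"
      using mult_right_mono[of 1000 "real X" "real X"] X by (simp add: power2_eq_square)
    then have "real (card Z) \<le> 63 / 100 * w X" using cZ X unfolding w_def by (simp add: field_simps)
    then show ?thesis using wX by (simp add: divide_le_eq)
  qed
  finally show ?thesis by (simp add: w_def)
qed auto

text \<open>Inclusion-exclusion with the overlap bound of the greedy choice. The overlap is measured
  against the final set \<open>covered a n\<close>, so that all steps refer to one set and their
  sums can be interchanged.\<close>

lemma covered_growth:
  assumes t: "1000 \<le> t" "t < n"
  shows "real (card (covered a (Suc t))) \<ge> real (card (covered a t)) + real (card (P t))
    - (\<Sum>s\<in>P t. real (card ((+) s ` window t \<inter> covered a n))) / (4 / 5 * real t ^ 2 - 11 / 5 * real t)"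
proof -
  define w where "w = 4 / 5 * real t ^ 2 - 11 / 5 * real t"
  define F where "F = free t (a ` {1000..<t})"
  define V where "V = (+) (a t) ` P t \<inter> covered a t"
  have w: "0 < w" using avail_mono(1)[of "real t" "real t"] t by (simp add: w_def)
  have F: "w \<le> real (card F)"
    unfolding F_def w_def using in_window t by (intro card_free_initial) auto
  have "covered a (Suc t) = covered a t \<union> (+) (a t) ` P t"
    using covered_Suc t by (simp add: P_def)
  then have "card (covered a (Suc t)) + card V = card (covered a t) + card (P t)"
    using card_Un_Int[of "covered a t" "(+) (a t) ` P t"]
    by (simp add: V_def Int_commute card_image)
  moreover have "real (card V) \<le> (\<Sum>s\<in>P t. real (card ((+) s ` window t \<inter> covered a n))) / w"
  proof -
    have "w * real (card V) \<le> real (card F) * real (card V)" using F by (intro mult_right_mono) auto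
    also have "\<dots> = real (card F * card V)" by simp
    also have "\<dots> \<le> real (\<Sum>s\<in>P t. card ((+) s ` window t \<inter> covered a t))"
      using small_overlap[OF t(1)] unfolding F_def V_def P_def by (intro of_nat_mono)
    also have "\<dots> = (\<Sum>s\<in>P t. real (card ((+) s ` window t \<inter> covered a t)))" by simp
    also have "\<dots> \<le> (\<Sum>s\<in>P t. real (card ((+) s ` window t \<inter> covered a n)))"
      using covered_mono[of t n a] t by (intro sum_mono of_nat_mono card_mono) auto
    finally show ?thesis using w by (simp add: field_simps)
  qed
  ultimately show ?thesis unfolding w_def by linarith
qed

text \<open>The growth estimates telescope. After interchanging sums, each covered \<open>y\<close>
  accounts for a loss of at most 0.63, so the total loss is at most 0.63 times the final
  size.\<close>

lemma card_covered_sum: "163 / 100 * real (card (covered a n)) \<ge> (\<Sum>t=1000..<n. real (card (P t)))"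
proof -
  define w where "w t = 4 / 5 * real t ^ 2 - 11 / 5 * real t" for t :: nat
  define S where "S = covered a n"
  define L where "L t = (\<Sum>s\<in>P t. real (card ((+) s ` window t \<inter> S))) / w t" for t
  have grow: "real (card (covered a m)) \<ge> (\<Sum>t=1000..<m. real (card (P t)) - L t)"
    if "m \<le> n" for m
    using that
  proof (induction m)
    case (Suc m)
    show ?case
    proof (cases "1000 \<le> m")
      case True
      then show ?thesis
        using covered_growth[of m n] Suc by (simp add: L_def S_def w_def)
    qed simp
  qed simp
  have "(\<Sum>t=1000..<n. L t) = (\<Sum>t=1000..<n. \<Sum>s\<in>P t. \<Sum>y\<in>S. of_bool (y \<in> (+) s ` window t) / w t)"
    unfolding L_def sum_divide_distrib
  proof (intro sum.cong refl)
    fix t s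
    have "real (card ((+) s ` window t \<inter> S)) = (\<Sum>y\<in>S. of_bool (y \<in> (+) s ` window t))"
      by (subst sum_of_bool_eq) (simp_all only: S_def finite_covered Collect_mem_eq Int_commute)
    then show "real (card ((+) s ` window t \<inter> S)) / w t = (\<Sum>y\<in>S. of_bool (y \<in> (+) s ` window t) / w t)"
      by (simp add: sum_divide_distrib)
  qed
  also have "\<dots> = (\<Sum>p\<in>(SIGMA t:{1000..<n}. P t). \<Sum>y\<in>S. case p of (t, s) \<Rightarrow> of_bool (y \<in> (+) s ` window t) / w t)"
    by (subst sum.Sigma) (simp_all add: case_prod_unfold)
  also have "\<dots> = (\<Sum>y\<in>S. \<Sum>p\<in>(SIGMA t:{1000..<n}. P t). case p of (t, s) \<Rightarrow> of_bool (y \<in> (+) s ` window t) / w t)"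
    by (rule sum.swap)
  also have "\<dots> \<le> (\<Sum>y\<in>S. 63 / 100)"
  proof (intro sum_mono)
    fix y
    have "(\<Sum>p\<in>(SIGMA t:{1000..<n}. P t). case p of (t, s) \<Rightarrow> of_bool (y \<in> (+) s ` window t) / w t)
      = (\<Sum>(t, s)\<in>{(t, s). t \<in> {1000..<n} \<and> s \<in> P t \<and> y \<in> (+) s ` window t}. 1 / w t)"
      by (intro sum.mono_neutral_cong_right) auto
    also have "\<dots> \<le> 63 / 100" using overlap_weight[of n y] by (simp add: w_def)
    finally show "(\<Sum>p\<in>(SIGMA t:{1000..<n}. P t). case p of (t, s) \<Rightarrow> of_bool (y \<in> (+) s ` window t) / w t) \<le> 63 / 100" .
  qed
  finally have "(\<Sum>t=1000..<n. L t) \<le> 63 / 100 * real (card S)" by simp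
  then show ?thesis using grow[of n] by (simp add: S_def sum_subtractf)
qed

end

section \<open>Lattice points with bounded sum of cubes\<close>

text \<open>
  The corners \<open>(30, 99), (40, 97), (50, 95), (60, 92), (70, 86), (79, 79)\<close> lie in \<open>x\<^sup>3 + y\<^sup>3 \<le> 100\<^sup>3\<close>;
  the part of this staircase with \<open>x < y\<close> has area \<open>4260.5\<close>.
\<close>

definition stair :: "nat \<Rightarrow> nat \<Rightarrow> nat" where
  "stair r i = 79 * r + (if i < 70 * r then 7 * r else 0) + (if i < 60 * r then 6 * r else 0)
    + (if i < 50 * r then 3 * r else 0) + (if i < 40 * r then 2 * r else 0)
    + (if i < 30 * r then 2 * r else 0)"

text \<open>Successors appear because \<open>a i\<close> is bounded by
  \<open>u (Suc i)\<close>.\<close>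

lemma stair_cubes:
  assumes "i < 79 * r" "j < stair r i"
  shows "Suc i ^ 3 + Suc j ^ 3 \<le> (100 * r) ^ 3"
proof -
  have *: "Suc i ^ 3 + Suc j ^ 3 \<le> (100 * r) ^ 3"
    if "Suc i \<le> p * r" "Suc j \<le> q * r" "p ^ 3 + q ^ 3 \<le> 100 ^ 3" for p q
  proof -
    have "Suc i ^ 3 + Suc j ^ 3 \<le> (p * r) ^ 3 + (q * r) ^ 3"
      using that by (intro add_mono power_mono) auto
    also have "\<dots> = (p ^ 3 + q ^ 3) * r ^ 3" by (simp add: power_mult_distrib algebra_simps)
    also have "\<dots> \<le> 100 ^ 3 * r ^ 3" using that by (intro mult_right_mono) auto
    finally show ?thesis by (simp add: power_mult_distrib)
  qed
  consider "i < 30 * r" | "30 * r \<le> i" "i < 40 * r" | "40 * r \<le> i" "i < 50 * r"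
    | "50 * r \<le> i" "i < 60 * r" | "60 * r \<le> i" "i < 70 * r" | "70 * r \<le> i" by linarith
  then show ?thesis
  proof cases
    case 1 then show ?thesis using assms by (intro *[of 30 99]) (auto simp: stair_def)
  next
    case 2 then show ?thesis using assms by (intro *[of 40 97]) (auto simp: stair_def)
  next
    case 3 then show ?thesis using assms by (intro *[of 50 95]) (auto simp: stair_def)
  next
    case 4 then show ?thesis using assms by (intro *[of 60 92]) (auto simp: stair_def)
  next
    case 5 then show ?thesis using assms by (intro *[of 70 86]) (auto simp: stair_def)
  next
    case 6 then show ?thesis using assms by (intro *[of 79 79]) (auto simp: stair_def)
  qed
qed

lemma stair_le: "stair r i \<le> 99 * r"
  by (auto simp: stair_def)

text \<open>7381 = 79 * 79 + 70 * 7 + 60 * 6 + 50 * 3 + 40 * 2 + 30 * 2, each layer contributing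
  width times height.\<close>

lemma sum_stair: "(\<Sum>i<79 * r. real (stair r i)) = 7381 * real r ^ 2"
proof -
  have *: "(\<Sum>i<79 * r. real (if i < k * r then c else 0)) = real (k * r) * real c"
    if "k \<le> 79" for k c
  proof -
    have "{..<79 * r} \<inter> {i. i < k * r} = {..<k * r}" using order_less_le_trans[OF _ mult_le_mono1[OF that, of r]] by auto
    then show ?thesis by (simp add: if_distrib sum.If_cases)
  qed
  show ?thesis
    unfolding stair_def of_nat_add sum.distrib
    by (simp add: * power2_eq_square)
qed

context greedy
begin

text \<open>Index pairs under the staircase at scale \<open>r\<close> have distinct sums in
  \<open>P t\<close>; its area 4260.5 r^2 is about 0.426 t^2.\<close>

lemma card_P:
  assumes t: "t \<ge> 1000"
  shows "real (card (P t)) \<ge> 213 / 500 * real t ^ 2 - 1100 * real t"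
proof -
  define r where "r = t div 100"
  define Q where "Q = (SIGMA i:{1000..<79 * r}. {i<..<stair r i})"
  have r: "100 * r \<le> t" "t < 100 * r + 100" by (auto simp: r_def)
  have "(\<lambda>(i, j). a i + a j) ` Q \<subseteq> P t"
  proof clarify
    fix i j assume "(i, j) \<in> Q"
    then have ij: "1000 \<le> i" "i < 79 * r" "i < j" "j < stair r i" by (auto simp: Q_def)
    have jt: "j < t" using ij(4) stair_le[of r i] r by linarith
    have "Suc i ^ 3 + Suc j ^ 3 \<le> (100 * r) ^ 3" using stair_cubes ij by simp
    also have "\<dots> \<le> t ^ 3" using r by (intro power_mono) auto
    finally have "u (Suc i) + u (Suc j) \<le> u t" by (rule u_add_le)
    then have "a i + a j \<le> u t" using a_bounds(2)[of i] a_bounds(2)[of j] ij by linarith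
    then show "a i + a j \<in> P t" using ij jt unfolding P_def low_sums_def by force
  qed
  moreover have "inj_on (\<lambda>(i, j). a i + a j) Q"
  proof (rule inj_onI, clarify)
    fix i j k l assume "(i, j) \<in> Q" "(k, l) \<in> Q" "a i + a j = a k + a l"
    then show "i = k \<and> j = l" using sum_unique[of i j k l] by (auto simp: Q_def)
  qed
  ultimately have "card Q \<le> card (P t)"
    by (metis card_image card_mono finite_P)
  define f where "f i = real (stair r i) - 1 - real i" for i
  have "(\<Sum>i<79 * r. f i) = 7381 * real r ^ 2 - 79 * real r - 79 * real r * (79 * real r - 1) / 2"
    by (simp add: f_def sum_subtractf sum_stair sum_lessThan_real)
  also have "\<dots> = 8521 / 2 * real r ^ 2 - 79 / 2 * real r"
    by (simp add: field_simps power2_eq_square)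
  finally have total: "(\<Sum>i<79 * r. f i) = 8521 / 2 * real r ^ 2 - 79 / 2 * real r" .
  have "(\<Sum>i<79 * r. f i) = (\<Sum>i\<in>{..<79 * r} \<inter> {..<1000}. f i) + (\<Sum>i\<in>{1000..<79 * r}. f i)"
    by (rule sum_lessThan_split)
  moreover have "(\<Sum>i\<in>{..<79 * r} \<inter> {..<1000}. f i) \<le> 1000 * real t"
  proof -
    have f: "f i \<le> real t" for i using stair_le[of r i] r by (simp add: f_def)
    have "(\<Sum>i\<in>{..<79 * r} \<inter> {..<1000}. f i) \<le> real (card ({..<79 * r} \<inter> {..<1000::nat})) * real t"
      using f by (intro sum_bounded_above) auto
    also have "\<dots> \<le> 1000 * real t"
      using card_mono[of "{..<1000::nat}" "{..<79 * r} \<inter> {..<1000}"] by (intro mult_right_mono) auto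
    finally show ?thesis .
  qed
  moreover have "(\<Sum>i\<in>{1000..<79 * r}. f i) \<le> real (card Q)"
    unfolding Q_def by (simp add: f_def) (intro sum_mono, linarith)
  \<comment> \<open>Rounding \<open>t\<close> to a multiple of 100 costs about 85 t, the omitted
    indices below 1000 at most 1000 t; both fit into 1100 t.\<close>
  moreover have "real r ^ 2 \<ge> ((real t - 99) / 100) ^ 2"
    using t r by (intro power_mono) auto
  then have "real r ^ 2 \<ge> real t ^ 2 / 10000 - 99 / 5000 * real t"
    by (simp add: power2_eq_square field_simps)
  moreover have "real t ^ 2 \<ge> 0" by simp
  moreover have "real r \<le> real t / 100" using r by simp
  ultimately show ?thesis using \<open>card Q \<le> card (P t)\<close> total by linarith
qed

section \<open>Lower density of the threefold sumset\<close>

lemma card_covered: "163 / 100 * real (card (covered a n)) \<ge> 71 / 500 * real n ^ 3 - 551 * real n ^ 2"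
proof -
  define f where "f t = 213 / 500 * real t ^ 2 - 1100 * real t" for t :: nat
  have closed: "(\<Sum>t<m. f t) = 71 / 1000 * real m * (real m - 1) * (2 * real m - 1) - 550 * real m * (real m - 1)" for m
    by (induction m) (simp_all add: f_def field_simps power2_eq_square)
  \<comment> \<open>Extending the sum down to 0 therefore only lowers it and permits the closed
    form.\<close>
  have neg: "f t \<le> 0" if "t < 1000" for t
  proof -
    have "real t * (213 / 500 * real t - 1100) \<le> 0" using that by (intro mult_nonneg_nonpos) auto
    then show ?thesis by (simp add: f_def power2_eq_square algebra_simps)
  qed
  have "(\<Sum>t<n. f t) = (\<Sum>t=1000..<n. f t) + (\<Sum>t\<in>{..<n} \<inter> {..<1000}. f t)"
    using sum_lessThan_split[of f n 1000] by simp
  then have "(\<Sum>t<n. f t) \<le> (\<Sum>t=1000..<n. f t)"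
    using sum_nonpos[of "{..<n} \<inter> {..<1000}" f] neg by auto
  also have "\<dots> \<le> (\<Sum>t=1000..<n. real (card (P t)))"
    unfolding f_def using card_P by (intro sum_mono) auto
  also have "\<dots> \<le> 163 / 100 * real (card (covered a n))" by (rule card_covered_sum)
  finally have "71 / 1000 * real n * (real n - 1) * (2 * real n - 1) - 550 * real n * (real n - 1)
      \<le> 163 / 100 * real (card (covered a n))" by (simp only: closed)
  moreover have "71 / 1000 * real n * (real n - 1) * (2 * real n - 1) - 550 * real n * (real n - 1)
     = 71 / 500 * real n ^ 3 - 550213 / 1000 * real n ^ 2 + 550071 / 1000 * real n"
    by (simp add: field_simps power2_eq_square power3_eq_cube)
  moreover have "real n ^ 2 \<ge> 0" by simp
  ultimately show ?thesis by linarith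
qed

lemma covered_subset:
  "covered a n \<subseteq> {x \<in> a ` {1000..} + a ` {1000..} + a ` {1000..}. 1 \<le> x \<and> x \<le> 2 * u n}"
proof
  fix x assume "x \<in> covered a n"
  then obtain t s where t: "1000 \<le> t" "t < n" "s \<in> P t" "x = a t + s"
    unfolding covered_def P_def[symmetric] by auto
  then obtain i j where ij: "1000 \<le> i" "i \<le> j" "j < t" "s = a i + a j" "s \<le> u t"
    by (elim P_elem)
  have mem: "a k \<in> a ` {1000..}" if "1000 \<le> k" for k
    using that by (intro imageI) simp
  have "x = a i + a j + a t" using t(4) ij(4) by linarith
  then have "x \<in> a ` {1000..} + a ` {1000..} + a ` {1000..}"
    using set_plus_intro[OF set_plus_intro[OF mem[of i] mem[of j]] mem[of t]] t(1) ij(1,2)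
    by (metis le_trans)
  moreover have "x \<le> 2 * u n"
    using t ij a_bounds(2)[of t] u_mono[of "Suc t" n] u_mono[of t n] by linarith
  moreover have "1 \<le> x" using t a_bounds(1)[of t] by linarith
  ultimately show "x \<in> {x \<in> a ` {1000..} + a ` {1000..} + a ` {1000..}. 1 \<le> x \<and> x \<le> 2 * u n}"
    by (intro CollectI conjI)
qed

lemma counting_lower:
  assumes n: "n \<ge> 10 ^ 6" and m: "2 * u n \<le> m" "m < 2 * u (Suc n)"
  shows "real (counting (a ` {1000..} + a ` {1000..} + a ` {1000..}) m) \<ge> 13 / 200 * real m"
proof -
  let ?B = "a ` {1000..} + a ` {1000..} + a ` {1000..}"
  have "covered a n \<subseteq> {x \<in> ?B. 1 \<le> x \<and> x \<le> m}" using covered_subset[of n] m by auto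
  then have "card (covered a n) \<le> counting ?B m"
    unfolding counting_def
    by (intro card_mono finite_subset[of "{x \<in> ?B. 1 \<le> x \<and> x \<le> m}" "{..m}"]) auto
  then have "163 / 100 * real (counting ?B m) \<ge> 71 / 500 * real n ^ 3 - 551 * real n ^ 2"
    using card_covered[of n] by linarith
  moreover have "real m \<le> 4 / 3 * real (Suc n) ^ 3"
    using m u_upper_real[of "Suc n"] by linarith
  moreover have "real (Suc n) ^ 3 = real n ^ 3 + 3 * real n ^ 2 + 3 * real n + 1"
    by (simp add: power3_eq_cube power2_eq_square algebra_simps)
  \<comment> \<open>0.142 exceeds 1.63 * 0.065 * 4/3 by more than 0.0007; for
    \<open>n \<ge> 10 ^ 6\<close> this surplus is over 700 n^2 and absorbs 551 n^2 and the expansion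
    of (n + 1)^3.\<close>
  moreover have "real n ^ 3 \<ge> 10 ^ 6 * real n ^ 2"
    using mult_right_mono[of "10 ^ 6" "real n" "real n ^ 2"] n
    by (simp add: power3_eq_cube power2_eq_square)
  moreover have "real n ^ 2 \<ge> 10 ^ 6 * real n"
    using mult_right_mono[of "10 ^ 6" "real n" "real n"] n by (simp add: power2_eq_square)
  moreover have "real n \<ge> 10 ^ 6" using n by simp
  ultimately show ?thesis by (simp add: field_simps)
qed

lemma lower_density_sumset:
  "lower_density (a ` {1000..} + a ` {1000..} + a ` {1000..}) > ereal 0.064"
proof -
  let ?B = "a ` {1000..} + a ` {1000..} + a ` {1000..}"
  have "real (counting ?B m) / real m \<ge> 13 / 200" if m: "m \<ge> 2 * u (10 ^ 6)" for m
  proof -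
    have "u (10 ^ 6) > 0" by (simp add: u_def)
    then have "real m > 0" using m by linarith
    \<comment> \<open>Cubic growth gives \<open>m < 2 * u (Suc m)\<close>, which bounds the
      candidates for the greatest \<open>n\<close> below.\<close>
    have "real (Suc m) \<le> real (Suc m) ^ 3" by (intro self_le_power) auto
    then have "real m < 2 * real (u (Suc m))"
      using u_lower_real[of "Suc m"] \<open>real m > 0\<close> of_nat_Suc[of m, where ?'a = real] by linarith
    then have "m < 2 * u (Suc m)" by linarith
    define n where "n = (GREATEST n. 2 * u n \<le> m)"
    have bound: "k \<le> m" if "2 * u k \<le> m" for k
      using that \<open>m < 2 * u (Suc m)\<close> u_mono[of "Suc m" k] by (meson le_trans leD mult_le_mono2 not_less_eq_eq)
    have n1: "2 * u n \<le> m" unfolding n_def by (rule GreatestI_nat[of _ "10 ^ 6" m]) (use m bound in auto)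
    have n2: "10 ^ 6 \<le> n" unfolding n_def by (rule Greatest_le_nat[of _ _ m]) (use m bound in auto)
    have n3: "m < 2 * u (Suc n)"
    proof (rule ccontr)
      assume "\<not> m < 2 * u (Suc n)"
      then have "Suc n \<le> (GREATEST n. 2 * u n \<le> m)"
        using bound by (intro Greatest_le_nat[of _ _ m]) auto
      then have "Suc n \<le> n" by (simp only: n_def[symmetric])
      then show False by simp
    qed
    show ?thesis using \<open>real m > 0\<close> counting_lower[OF n2 n1 n3] by (simp add: field_simps)
  qed
  then have "eventually (\<lambda>m. ereal (13 / 200) \<le> ereal (real (counting ?B m) / real m)) sequentially"
    unfolding eventually_sequentially by auto
  then have "ereal (13 / 200) \<le> lower_density ?B"
    unfolding lower_density_def by (rule Liminf_bounded)
  moreover have "ereal 0.064 < ereal (13 / 200)" by simp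
  ultimately show ?thesis by (rule less_le_trans[rotated])
qed

end

theorem theorem4:
  "\<exists>A :: nat set. sidon A \<and> lower_density (A + A + A) > ereal 0.064"
proof -
  obtain a where "greedy a" using greedy_exists ..
  then interpret greedy a .
  show ?thesis using sidon lower_density_sumset by blast
qed

end
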